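(* The following identity holds: \[ \sum_{n=0}^{\infty} \frac{(\frac12)_n^7\, (\frac14)_n\, (\frac34)_n}{n!^9}\,\frac{1}{2^{12 n}}\,\bigl(43680n^4 +20632n^3+4340n^2+466n+21\bigr)=\frac{2048}{\pi^4}. \]
   Context: Here $(a)_n$ denotes the rising factorial (Pochhammer symbol): $(a)_0=1$ and $(a)_n=a(a+1)\cdots(a+n-1)$ for positive integers $n$. *)

theory Defs
  imports Complex_Main
begin

end

theory Submission
  imports Defs "HOL-Analysis.Analysis" "HOL-Real_Asymp.Real_Asymp"
begin

text \<open>The sum is evaluated by the method of Wilf and Zeilberger, used twice. A WZ pair is a pair of functions with
F(n+1,k) - F(n,k) = G(n,k+1) - G(n,k). If F vanishes at n = 0 and as n tends to infinity, then summing over n shows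
that the sum of G(n,k) over n does not depend on k, so it may be computed in the limit of large k, where dominated
convergence reduces it to the sum of the termwise limits. This is lemma wz_sums.

Both pairs come from summation formulas of Dougall. Divide the summand of such a formula by the value of its sum and
shift the parameters linearly in n: the sum over k stays constant, and Gosper's algorithm finds a companion G that is
F times a rational function. For the given series the source is the very-well-poised 7F6 with
a = 5n - 1/2, all five numerator parameters equal to 2n, and summation index k - n + 1/2. Up to a constant factor,

  F(n,k) = (-1)^n (3n + 2k + 1/2) Gamma(n+1/2)^10 Gamma(n+k+1/2)^5 Gamma(4n+k)
           / (Gamma(2n)^5 Gamma(2n+k+1)^5 Gamma(k-n+3/2)).

The factor 1 / Gamma(2n)^5 kills F at n = 0, and F decays geometrically in n. At k = 0 the companion G is the summand
of the theorem. For k tending to infinity it tends to 16 / pi^2 times the summand of Guillera's series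

  sum over n of (-1)^n ((1/2)_n / n!)^5 2^(-10n) (820 n^2 + 180 n + 13) = 128 / pi^2.

That series is in turn summed by a second pair, coming from the very-well-poised 5F4 with all four parameters equal to
1/2 - n and summation index 2n + k:

  F(n,k) = (-1)^n (3n + 2k + 1/2) Gamma(n+1/2)^6 Gamma(n+k+1/2)^4 / (Gamma(2n) Gamma(2n+k+1)^4).

There only the term n = 0 of G survives as k tends to infinity. Its limit 128 / pi^2, like the factor 16 / pi^2 above,
is given by the product of Wallis.

In both cases G(n,k) = D(n,k) p(n,k) with a hypergeometric term D (guillera_term, cullen_term) and a polynomial p
(guillera_poly, cullen_poly). After division by D the WZ equation is a polynomial identity in n and k
(guillera_poly_id, cullen_poly_id). The domination uniform in k holds because D(n+1,k) / D(n,k) is at most 1/4 in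
absolute value while D(0,k) decays in k exactly as fast as p grows.\<close>

section \<open>Summation by a WZ pair\<close>

lemma wz_sums:
  fixes F G :: "nat \<Rightarrow> nat \<Rightarrow> real"
  assumes wz: "\<And>n k. F (Suc n) k - F n k = G n (Suc k) - G n k"
    and F0: "\<And>k. F 0 k = 0" and Flim: "\<And>k. (\<lambda>n. F n k) \<longlonglongrightarrow> 0"
    and bound: "\<And>n k. \<bar>G n k\<bar> \<le> b n" and b: "summable b"
    and lim: "\<And>n. (\<lambda>k. G n k) \<longlonglongrightarrow> g n" and g: "g sums s"
  shows "(\<lambda>n. G n 0) sums s"
proof -
  have sm: "summable (\<lambda>n. G n k)" for k
    by (rule summable_comparison_test'[OF b, of 0]) (simp add: bound)
  have "(\<Sum>n. G n (Suc k)) = (\<Sum>n. G n k)" for k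
  proof -
    have "(\<Sum>n<N. G n (Suc k) - G n k) = F N k" for N
      using sum_lessThan_telescope[of "\<lambda>n. F n k" N] by (simp add: wz F0)
    hence "(\<lambda>n. G n (Suc k) - G n k) sums 0"
      by (simp add: sums_def Flim)
    thus ?thesis
      using suminf_diff[OF sm[of "Suc k"] sm[of k]] by (simp add: sums_iff)
  qed
  hence const: "(\<Sum>n. G n k) = (\<Sum>n. G n 0)" for k
    by (induction k) auto
  have "(\<lambda>k. \<Sum>n. G n k) \<longlonglongrightarrow> suminf g"
    by (rule tannerys_theorem[THEN conjunct2, THEN conjunct2, OF lim _ b])
       (simp_all add: bound always_eventually)
  moreover have "(\<lambda>k. \<Sum>n. G n k) = (\<lambda>_. \<Sum>n. G n 0)"
    using const by (rule ext)
  ultimately have "(\<Sum>n. G n 0) = s"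
    using g by (simp add: LIMSEQ_const_iff sums_iff)
  thus ?thesis
    using sm[of 0] by (simp add: sums_iff)
qed

section \<open>Domination uniform in k\<close>

text \<open>The degrees in the two variables are kept apart, because the power of k has to match exactly the decay of the
hypergeometric term at n = 0, whereas any power of n is absorbed by the geometric decay.\<close>

definition poly_growth :: "nat \<Rightarrow> nat \<Rightarrow> (nat \<Rightarrow> nat \<Rightarrow> real) \<Rightarrow> bool" where
  "poly_growth p q f \<longleftrightarrow> (\<exists>C\<ge>0. \<forall>n k. \<bar>f n k\<bar> \<le> C * (real n + 1) ^ p * (real k + 1) ^ q)"

lemma poly_growth_const: "poly_growth p q (\<lambda>n k. c)"
proof -
  have "\<bar>c\<bar> * 1 * 1 \<le> \<bar>c\<bar> * (real n + 1) ^ p * (real k + 1) ^ q" for n k :: nat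
    by (intro mult_mono) auto
  thus ?thesis unfolding poly_growth_def by (intro exI[of _ "\<bar>c\<bar>"]) auto
qed

lemma poly_growth_add:
  assumes "poly_growth p q f" "poly_growth p q g"
  shows "poly_growth p q (\<lambda>n k. f n k + g n k)"
proof -
  from assms obtain C D where *: "C \<ge> 0" "D \<ge> 0"
    "\<And>n k. \<bar>f n k\<bar> \<le> C * (real n + 1) ^ p * (real k + 1) ^ q"
    "\<And>n k. \<bar>g n k\<bar> \<le> D * (real n + 1) ^ p * (real k + 1) ^ q"
    unfolding poly_growth_def by blast
  have "\<bar>f n k + g n k\<bar> \<le> (C + D) * (real n + 1) ^ p * (real k + 1) ^ q" for n k
    using *(3,4)[of n k] by (simp add: algebra_simps)
  thus ?thesis unfolding poly_growth_def using *(1,2) by (intro exI[of _ "C + D"]) auto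
qed

lemma poly_growth_mult_n:
  assumes "poly_growth (p - 1) q f" and "p > 0"
  shows "poly_growth p q (\<lambda>n k. real n * f n k)"
proof -
  from assms obtain C where *: "C \<ge> 0"
    "\<And>n k. \<bar>f n k\<bar> \<le> C * (real n + 1) ^ (p - 1) * (real k + 1) ^ q"
    unfolding poly_growth_def by blast
  have "\<bar>real n * f n k\<bar> \<le> C * (real n + 1) ^ p * (real k + 1) ^ q" for n k
  proof -
    have "real n * \<bar>f n k\<bar> \<le> (real n + 1) * (C * (real n + 1) ^ (p - 1) * (real k + 1) ^ q)"
      by (intro mult_mono *) auto
    thus ?thesis using \<open>p > 0\<close> by (cases p) (simp_all add: abs_mult mult_ac)
  qed
  thus ?thesis unfolding poly_growth_def using *(1) by blast
qed

lemma poly_growth_mult_k: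
  assumes "poly_growth p (q - 1) f" and "q > 0"
  shows "poly_growth p q (\<lambda>n k. real k * f n k)"
proof -
  from assms obtain C where *: "C \<ge> 0"
    "\<And>n k. \<bar>f n k\<bar> \<le> C * (real n + 1) ^ p * (real k + 1) ^ (q - 1)"
    unfolding poly_growth_def by blast
  have "\<bar>real k * f n k\<bar> \<le> C * (real n + 1) ^ p * (real k + 1) ^ q" for n k
  proof -
    have "real k * \<bar>f n k\<bar> \<le> (real k + 1) * (C * (real n + 1) ^ p * (real k + 1) ^ (q - 1))"
      by (intro mult_mono *) auto
    thus ?thesis using \<open>q > 0\<close> by (cases q) (simp_all add: abs_mult mult_ac)
  qed
  thus ?thesis unfolding poly_growth_def using *(1) by blast
qed

lemma poly_growth_mult:
  assumes "poly_growth p q f" "poly_growth p' q' g"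
  shows "poly_growth (p + p') (q + q') (\<lambda>n k. f n k * g n k)"
proof -
  from assms obtain C D where *: "C \<ge> 0" "D \<ge> 0"
    "\<And>n k. \<bar>f n k\<bar> \<le> C * (real n + 1) ^ p * (real k + 1) ^ q"
    "\<And>n k. \<bar>g n k\<bar> \<le> D * (real n + 1) ^ p' * (real k + 1) ^ q'"
    unfolding poly_growth_def by blast
  have "\<bar>f n k * g n k\<bar> \<le> (C * D) * (real n + 1) ^ (p + p') * (real k + 1) ^ (q + q')" for n k
  proof -
    have "\<bar>f n k\<bar> * \<bar>g n k\<bar> \<le> (C * (real n + 1) ^ p * (real k + 1) ^ q) * (D * (real n + 1) ^ p' * (real k + 1) ^ q')"
      using *(1,2) by (intro mult_mono *(3,4)) auto
    thus ?thesis by (simp add: abs_mult power_add mult_ac)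
  qed
  thus ?thesis unfolding poly_growth_def using *(1,2) by (intro exI[of _ "C * D"]) auto
qed

lemma poly_growth_power:
  assumes "poly_growth p q f"
  shows "poly_growth (m * p) (m * q) (\<lambda>n k. f n k ^ m)"
  by (induction m) (auto intro: poly_growth_const poly_growth_mult[OF assms])

lemmas poly_growth_horner = poly_growth_const poly_growth_add poly_growth_mult_n poly_growth_mult_k

lemma tendsto_poly_geometric: "(\<lambda>n. (real n + 1) ^ p * (1/4) ^ n) \<longlonglongrightarrow> 0"
  by real_asymp

lemma summable_poly_geometric: "summable (\<lambda>n. (real n + 1) ^ p * (1/4 :: real) ^ n)"
proof (rule summable_comparison_test_bigo)
  show "summable (\<lambda>n. norm ((1/2 :: real) ^ n))" by (simp add: summable_geometric)
  show "(\<lambda>n. (real n + 1) ^ p * (1/4 :: real) ^ n) \<in> O(\<lambda>n. (1/2) ^ n)" by real_asymp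
qed

lemma geometric_bound:
  fixes D :: "nat \<Rightarrow> nat \<Rightarrow> real"
  assumes "\<And>n. \<bar>D (Suc n) k\<bar> \<le> \<bar>D n k\<bar> / 4"
  shows "\<bar>D n k\<bar> \<le> \<bar>D 0 k\<bar> * (1/4) ^ n"
proof (induction n)
  case (Suc n)
  show ?case using assms[of n] Suc by simp
qed auto

lemma tendsto_0_if_poly_growth:
  fixes D P :: "nat \<Rightarrow> nat \<Rightarrow> real"
  assumes D: "\<And>n. \<bar>D (Suc n) k\<bar> \<le> \<bar>D n k\<bar> / 4" and P: "poly_growth p q P"
    and F: "\<And>n. \<bar>F n\<bar> \<le> \<bar>D n k * P n k\<bar>"
  shows "F \<longlonglongrightarrow> 0"
proof -
  from P obtain C where C: "C \<ge> 0"
    "\<And>n k. \<bar>P n k\<bar> \<le> C * (real n + 1) ^ p * (real k + 1) ^ q"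
    unfolding poly_growth_def by blast
  have "\<bar>F n\<bar> \<le> (\<bar>D 0 k\<bar> * C * (real k + 1) ^ q) * ((real n + 1) ^ p * (1/4) ^ n)" for n
  proof -
    have "\<bar>D n k\<bar> * \<bar>P n k\<bar> \<le> (\<bar>D 0 k\<bar> * (1/4) ^ n) * (C * (real n + 1) ^ p * (real k + 1) ^ q)"
      using C by (intro mult_mono geometric_bound D) auto
    thus ?thesis using F[of n] by (simp add: abs_mult mult_ac)
  qed
  hence "\<forall>n. norm (F n) \<le> (\<bar>D 0 k\<bar> * C * (real k + 1) ^ q) * ((real n + 1) ^ p * (1/4) ^ n)"
    by simp
  thus ?thesis
    by (rule Lim_null_comparison[OF always_eventually tendsto_mult_right_zero[OF tendsto_poly_geometric[of p]]])
qed

lemma uniform_bound_if_poly_growth: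
  fixes D P :: "nat \<Rightarrow> nat \<Rightarrow> real"
  assumes D: "\<And>n k. \<bar>D (Suc n) k\<bar> \<le> \<bar>D n k\<bar> / 4" and P: "poly_growth p q P"
    and D0: "\<And>k. \<bar>D 0 k\<bar> \<le> c / (real k + 1) ^ q"
  shows "\<exists>b. summable b \<and> (\<forall>n k. \<bar>D n k * P n k\<bar> \<le> b n)"
proof -
  from P obtain C where C: "C \<ge> 0"
    "\<And>n k. \<bar>P n k\<bar> \<le> C * (real n + 1) ^ p * (real k + 1) ^ q"
    unfolding poly_growth_def by blast
  have "\<bar>D n k * P n k\<bar> \<le> c * C * ((real n + 1) ^ p * (1/4) ^ n)" for n k
  proof -
    have "\<bar>D n k\<bar> \<le> c / (real k + 1) ^ q * (1/4) ^ n"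
      by (rule order_trans[OF geometric_bound[of D, OF D] mult_right_mono[OF D0]]) auto
    hence "\<bar>D n k\<bar> * \<bar>P n k\<bar> \<le> (c / (real k + 1) ^ q * (1/4) ^ n) * (C * (real n + 1) ^ p * (real k + 1) ^ q)"
      using C by (intro mult_mono) (auto intro: order_trans[OF abs_ge_zero])
    also have "\<dots> = c * C * ((real n + 1) ^ p * (1/4) ^ n)"
      by (simp add: field_simps)
    finally show ?thesis by (simp add: abs_mult)
  qed
  moreover have "summable (\<lambda>n. c * C * ((real n + 1) ^ p * (1/4) ^ n))"
    by (rule summable_mult[OF summable_poly_geometric])
  ultimately show ?thesis by blast
qed

section \<open>The Pochhammer symbol of 1/2\<close>

abbreviation (input) hp :: "nat \<Rightarrow> real" where "hp \<equiv> pochhammer (1/2)"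

lemma hp_Suc: "hp (Suc n) = (real n + 1/2) * hp n"
  by (simp add: pochhammer_Suc add_ac)

lemma hp_pos: "hp n > 0"
  by (rule pochhammer_pos) simp

lemma fact_double_hp: "fact (2 * n) = 4 ^ n * hp n * fact n"
  by (simp add: fact_double power_mult)

lemma hp_bound: "(hp k / fact k) ^ 2 * (real k + 1) \<le> 1"
proof (induction k)
  case (Suc k)
  have "(hp (Suc k) / fact (Suc k)) ^ 2 * (real (Suc k) + 1) =
     ((hp k / fact k) ^ 2 * (real k + 1)) * ((real k + 1/2) ^ 2 * (real k + 2) / (real k + 1) ^ 3)"
    by (simp add: hp_Suc divide_simps) (simp add: power2_eq_square power3_eq_cube algebra_simps)
  also have "(real k + 1/2) ^ 2 * (real k + 2) \<le> (real k + 1) ^ 3"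
    by (simp add: power2_eq_square power3_eq_cube algebra_simps)
  hence "(hp k / fact k) ^ 2 * (real k + 1) * ((real k + 1/2) ^ 2 * (real k + 2) / (real k + 1) ^ 3) \<le> 1 * 1"
    by (intro mult_mono Suc.IH) auto
  finally show ?case by simp
qed auto

text \<open>The square of (1/2)_n / n! times 2n + 1 is the reciprocal of the n-th Wallis product. This is the only place where pi
enters the proof.\<close>

lemma wallis_hp: "(\<lambda>k. (hp k / fact k) ^ 2 * real k) \<longlonglongrightarrow> 1 / pi"
proof -
  have *: "(\<Prod>k=1..n. (4 * real k ^ 2) / (4 * real k ^ 2 - 1)) = inverse ((hp n / fact n) ^ 2 * (2 * real n + 1))" for n
  proof (induction n)
    case (Suc n)
    have "(\<Prod>k=1..Suc n. (4 * real k ^ 2) / (4 * real k ^ 2 - 1)) =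
            inverse ((hp n / fact n) ^ 2 * (2 * real n + 1)) * (4 * real (Suc n) ^ 2 / (4 * real (Suc n) ^ 2 - 1))"
      by (simp only: Suc.IH[symmetric]) simp
    also have "4 * real (Suc n) ^ 2 - 1 = (2 * real n + 1) * (2 * real n + 3)"
      by (simp add: power2_eq_square algebra_simps)
    also have "inverse ((hp n / fact n) ^ 2 * (2 * real n + 1)) * (4 * real (Suc n) ^ 2 / ((2 * real n + 1) * (2 * real n + 3))) =
               inverse (((real n + 1/2) * hp n / (real (Suc n) * fact n)) ^ 2 * (2 * real n + 3))"
      using hp_pos[of n] by (simp add: divide_simps) (simp add: power2_eq_square algebra_simps)
    finally show ?case by (simp add: hp_Suc add_ac)
  qed auto
  have "(\<lambda>n. inverse (\<Prod>k=1..n. (4 * real k ^ 2) / (4 * real k ^ 2 - 1))) \<longlonglongrightarrow> inverse (pi / 2)"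
    by (rule tendsto_inverse[OF wallis]) auto
  hence "(\<lambda>n. (hp n / fact n) ^ 2 * (2 * real n + 1)) \<longlonglongrightarrow> 2 / pi"
    by (simp only: * inverse_inverse_eq) simp
  moreover have "(\<lambda>n. real n / (2 * real n + 1)) \<longlonglongrightarrow> 1 / 2" by real_asymp
  ultimately have "(\<lambda>n. (hp n / fact n) ^ 2 * (2 * real n + 1) * (real n / (2 * real n + 1))) \<longlonglongrightarrow> 2 / pi * (1 / 2)"
    by (rule tendsto_mult)
  moreover have "(hp n / fact n) ^ 2 * (2 * real n + 1) * (real n / (2 * real n + 1)) = (hp n / fact n) ^ 2 * real n" for n
    by simp
  ultimately show ?thesis by simp
qed

section \<open>A series of Guillera for 1 / pi^2\<close>

text \<open>This is the certificate produced by Gosper's algorithm for the 5F4 pair, cleared of denominators. It is written in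
nested form so that degrees and leading coefficients can be read off rule by rule.\<close>

definition guillera_poly :: "real \<Rightarrow> real \<Rightarrow> real" where
  "guillera_poly n k =
   (13 + n * (284 + n * (2572 + n * (11296 + n * (25648 + n * (29120 + n * 13120)))))) + k * (
   (124 + n * (2264 + n * (15200 + n * (46784 + n * (67264 + n * 36736))))) + k * (
   (480 + n * (6656 + n * (31488 + n * (61440 + n * 42496)))) + k * (
   (960 + n * (9344 + n * (27904 + n * 26112))) + k * (
   (1040 + n * (6336 + n * 9024)) + k * (
   (576 + n * 1664) + k * (
   128))))))"

lemma guillera_poly_growth: "poly_growth 6 6 (\<lambda>n k. guillera_poly (real n) (real k))"
  unfolding guillera_poly_def by (intro poly_growth_horner) simp_all

text \<open>The WZ equation of the 5F4 pair, divided by guillera_term n k and multiplied by (2n+k+2)^4.\<close>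

lemma guillera_poly_id:
  "(n + k + 1/2) ^ 4 * guillera_poly n (k+1) - (2*n+k+2)^4 * guillera_poly n k =
   - 64 * (3*n+2*k+7/2) * (n+k+1/2)^4 * (n+1/2)^5 - 256 * n * (3*n+2*k+1/2) * ((2*n+k+1)*(2*n+k+2))^4"
  unfolding guillera_poly_def by algebra

lemma guillera_poly_0: "guillera_poly n 0 = (2*n+1)^4 * (820*n^2+180*n+13)"
  unfolding guillera_poly_def by algebra

lemma guillera_poly_lim: "(\<lambda>k. guillera_poly n (real k) / (real k + 1) ^ 6) \<longlonglongrightarrow> 128"
  unfolding guillera_poly_def by real_asymp

definition guillera_term :: "nat \<Rightarrow> nat \<Rightarrow> real" where
  "guillera_term n k = (-1) ^ n * hp (n + k) ^ 4 * hp n ^ 6 / (fact (2*n+k+1) ^ 4 * fact (2*n))"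

lemma guillera_term_Suc_n: "guillera_term (Suc n) k =
  - guillera_term n k * ((real n + real k + 1/2) / ((2*real n+real k+2) * (2*real n+real k+3))) ^ 4 * ((real n+1/2) ^ 5 / (4 * (real n + 1)))"
proof -
  have f: "fact (2 * Suc n + k + 1) = ((2*real n+real k+2) * (2*real n+real k+3)) * fact (2*n+k+1)"
    by (simp add: algebra_simps)
  have g: "fact (2 * Suc n) = (4 * (real n + 1)) * (real n + 1/2) * fact (2 * n)"
    by (simp add: algebra_simps)
  have h: "hp (Suc n + k) = (real n + real k + 1/2) * hp (n + k)"
    by (simp add: hp_Suc)
  have *: "(-1) ^ Suc n * (a * H) ^ 4 * (b * h) ^ 6 / ((c * F) ^ 4 * (m * b * g)) =
      - ((-1) ^ n * H ^ 4 * h ^ 6 / (F ^ 4 * g)) * (a / c) ^ 4 * (b ^ 5 / m)"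
    if "b \<noteq> 0" for a b c m F H g h :: real
    using that by (simp add: power_mult_distrib power_divide power_Suc[of b 5, simplified] ac_simps)
  show ?thesis
    unfolding guillera_term_def f g h hp_Suc by (rule *) (simp add: add_nonneg_eq_0_iff)
qed

lemma guillera_term_Suc_k: "guillera_term n (Suc k) =
  guillera_term n k * ((real n + real k + 1/2) / (2*real n+real k+2)) ^ 4"
proof -
  have f: "fact (2 * n + Suc k + 1) = (2*real n+real k+2) * fact (2*n+k+1)"
    by (simp add: algebra_simps)
  have h: "hp (n + Suc k) = (real n + real k + 1/2) * hp (n + k)"
    by (simp add: hp_Suc)
  show ?thesis
    unfolding guillera_term_def f h by (simp only: power_mult_distrib power_divide times_divide_times_eq ac_simps)
qed

text \<open>In the ratio of consecutive terms the quotient (n+1/2)^5 / (n+1) grows like n^4. It is compensated by the fourth power of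
(n+k+1/2) / ((2n+k+2)(2n+k+3)), which is at most 1 / (n+1)^4; what remains is the factor 1/4.\<close>

lemma guillera_term_decay: "\<bar>guillera_term (Suc n) k\<bar> \<le> \<bar>guillera_term n k\<bar> / 4"
proof -
  have "(real n + real k + 1/2) / ((2*real n+real k+2) * (2*real n+real k+3)) \<le> 1 / (2*real n+real k+3)"
    by (simp add: divide_simps)
  hence "((real n + real k + 1/2) / ((2*real n+real k+2) * (2*real n+real k+3))) ^ 4 \<le> (1 / (2*real n+real k+3)) ^ 4"
    by (intro power_mono) auto
  also have "\<dots> \<le> (1 / (real n + 1)) ^ 4"
    by (intro power_mono divide_left_mono) auto
  finally have 1: "((real n + real k + 1/2) / ((2*real n+real k+2) * (2*real n+real k+3))) ^ 4 \<le> (1 / (real n + 1)) ^ 4" .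
  have 2: "(real n+1/2) ^ 5 / (4 * (real n + 1)) \<le> (real n+1) ^ 5 / (4 * (real n + 1))"
    by (intro divide_right_mono power_mono) auto
  have "((real n + real k + 1/2) / ((2*real n+real k+2) * (2*real n+real k+3))) ^ 4 * ((real n+1/2) ^ 5 / (4 * (real n + 1)))
    \<le> (1 / (real n + 1)) ^ 4 * ((real n+1) ^ 5 / (4 * (real n + 1)))"
    by (intro mult_mono 1 2) auto
  also have "\<dots> = 1 / 4" by (simp add: power_eq_if divide_simps)
  finally have "\<bar>guillera_term n k\<bar> * (((real n + real k + 1/2) / ((2*real n+real k+2) * (2*real n+real k+3))) ^ 4 * ((real n+1/2) ^ 5 / (4 * (real n + 1)))) \<le> \<bar>guillera_term n k\<bar> * (1 / 4)"
    by (intro mult_left_mono) auto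
  thus ?thesis by (simp add: guillera_term_Suc_n abs_mult mult.assoc)
qed

lemma guillera_term_0: "guillera_term 0 k = ((hp k / fact k) ^ 2 * (real k + 1)) ^ 2 / (real k + 1) ^ 6"
proof -
  have "h ^ 4 / (x * f) ^ 4 = ((h / f) ^ 2 * x) ^ 2 / x ^ 6" if "x > 0" for h f x :: real
    using that by (simp add: power_mult_distrib power_divide divide_simps flip: power_mult power_add)
  from this[of "real k + 1" "hp k" "fact k"] show ?thesis
    by (simp add: guillera_term_def add_ac)
qed

theorem guillera_sums:
  "(\<lambda>n. (-1) ^ n * (hp n / (fact n * 4 ^ n)) ^ 5 * (820 * real n ^ 2 + 180 * real n + 13)) sums (128 / pi ^ 2)"
proof -
  define G where "G = (\<lambda>n k. guillera_term n k * guillera_poly (real n) (real k))"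
  define P where "P = (\<lambda>n k. 256 * n * (3*n+2*k+1/2) * (2*n+k+1) ^ 4 :: real)"
  define F where "F = (\<lambda>n k. guillera_term n k * P (real n) (real k))"
  have wz: "F (Suc n) k - F n k = G n (Suc k) - G n k" for n k
  proof -
    define t x y X where "t = guillera_term n k" and "x = real n" and "y = real k" and "X = 2*x+y+2"
    have "X > 0" "x + 1 > 0" "2*x+y+3 > 0" unfolding X_def x_def y_def by auto
    hence nz: "X \<noteq> 0" "x + 1 \<noteq> 0" "2*x+y+3 \<noteq> 0" by auto
    have "F (Suc n) k = - t * ((x+y+1/2) / (X * (2*x+y+3))) ^ 4 * ((x+1/2)^5 / (4 * (x+1))) *
             (256 * (x+1) * (3*x+2*y+7/2) * (2*x+y+3)^4)"
    proof -
      have "P (real (Suc n)) (real k) = 256 * (x+1) * (3*x+2*y+7/2) * (2*x+y+3)^4"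
        by (simp add: P_def x_def y_def algebra_simps)
      thus ?thesis
        by (simp only: F_def guillera_term_Suc_n t_def x_def y_def X_def)
    qed
    also have "\<dots> = - 64 * t * (3*x+2*y+7/2) * (x+y+1/2)^4 * (x+1/2)^5 / X^4"
      using nz by (simp add: power_mult_distrib power_divide del: distrib_left_numeral)
    finally have F: "F (Suc n) k = - 64 * t * (3*x+2*y+7/2) * (x+y+1/2)^4 * (x+1/2)^5 / X^4" .
    \<comment> \<open>Multiplying by X^4 clears all denominators and leads to the polynomial identity.\<close>
    have 1: "X ^ 4 * F (Suc n) k = t * (- 64 * (3*x+2*y+7/2) * (x+y+1/2)^4 * (x+1/2)^5)"
      unfolding F using nz by (simp add: mult_ac del: distrib_left_numeral)
    have 2: "X ^ 4 * F n k = t * (256 * x * (3*x+2*y+1/2) * ((2*x+y+1)*X)^4)"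
      by (simp only: F_def P_def t_def x_def y_def power_mult_distrib mult_ac)
    have "X ^ 4 * (F (Suc n) k - F n k) =
        t * (- 64 * (3*x+2*y+7/2) * (x+y+1/2)^4 * (x+1/2)^5 - 256 * x * (3*x+2*y+1/2) * ((2*x+y+1)*X)^4)"
      unfolding right_diff_distrib[of "X ^ 4"] 1 2 by (rule right_diff_distrib[symmetric])
    also have "\<dots> = t * ((x+y+1/2)^4 * guillera_poly x (y+1) - X^4 * guillera_poly x y)"
      by (simp only: guillera_poly_id X_def)
    also have "\<dots> = X ^ 4 * G n (Suc k) - X ^ 4 * G n k"
    proof -
      have "G n (Suc k) = t * ((x+y+1/2) / X) ^ 4 * guillera_poly x (y+1)"
        by (simp add: G_def guillera_term_Suc_k t_def x_def y_def X_def add_ac)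
      thus ?thesis
        using nz by (simp add: G_def power_divide right_diff_distrib flip: t_def x_def y_def)
    qed
    finally have "X ^ 4 * (F (Suc n) k - F n k) = X ^ 4 * (G n (Suc k) - G n k)"
      by (simp only: right_diff_distrib)
    thus ?thesis using nz by simp
  qed
  have lin: "poly_growth 1 1 (\<lambda>n k. a + (real n * b + real k * c))" for a b c
    by (intro poly_growth_horner) simp_all
  have P: "poly_growth (1 + (1 + 4 * 1)) (1 + (1 + 4 * 1)) (\<lambda>n k. P (real n) (real k))"
    using poly_growth_mult[OF lin[of 0 256 0] poly_growth_mult[OF lin[of "1/2" 3 2] poly_growth_power[OF lin[of 1 2 1], of 4]]]
    by (simp add: P_def algebra_simps)
  have F_lim: "(\<lambda>n. F n k) \<longlonglongrightarrow> 0" for k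
    by (rule tendsto_0_if_poly_growth[where D = guillera_term and k = k, OF guillera_term_decay P]) (simp add: F_def)
  have "\<bar>guillera_term 0 k\<bar> \<le> 1 / (real k + 1) ^ 6" for k
    unfolding guillera_term_0 using hp_bound[of k] by (simp add: divide_right_mono power_le_one)
  from uniform_bound_if_poly_growth[OF guillera_term_decay guillera_poly_growth this]
  obtain b where b: "summable b" "\<And>n k. \<bar>G n k\<bar> \<le> b n"
    unfolding G_def by blast
  have w: "(\<lambda>k. (hp k / fact k) ^ 2 * (real k + 1)) \<longlonglongrightarrow> 1 / pi"
  proof -
    have "(\<lambda>k. (hp k / fact k) ^ 2 * real k * (1 + 1 / real k)) \<longlonglongrightarrow> 1 / pi * 1"
      by (intro tendsto_mult wallis_hp) real_asymp
    moreover have "\<forall>\<^sub>F k in sequentially. (hp k / fact k) ^ 2 * real k * (1 + 1 / real k) = (hp k / fact k) ^ 2 * (real k + 1)"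
      using eventually_gt_at_top[of 0] by eventually_elim (simp add: field_simps)
    ultimately show ?thesis by (simp add: filterlim_cong)
  qed
  have lim: "(\<lambda>k. guillera_term n k * (real k + 1) ^ 6) \<longlonglongrightarrow> (if n = 0 then 1 / pi ^ 2 else 0)" for n
  proof (induction n)
    case 0
    show ?case using tendsto_power[OF w, of 2] by (simp add: guillera_term_0 power_divide)
  next
    case (Suc n)
    have "(\<lambda>k. guillera_term n k * (real k + 1) ^ 6 * (- (((real n + real k + 1/2) / ((2*real n+real k+2) * (2*real n+real k+3))) ^ 4) * ((real n+1/2) ^ 5 / (4 * (real n + 1)))))
      \<longlonglongrightarrow> (if n = 0 then 1 / pi ^ 2 else 0) * (- (0 ^ 4) * ((real n+1/2) ^ 5 / (4 * (real n + 1))))"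
      by (intro tendsto_mult Suc.IH tendsto_const tendsto_minus tendsto_power) real_asymp
    thus ?case by (simp add: guillera_term_Suc_n mult_ac)
  qed
  have lim: "(\<lambda>k. G n k) \<longlonglongrightarrow> (if n = 0 then 128 / pi ^ 2 else 0)" for n
  proof -
    have "(\<lambda>k. (guillera_term n k * (real k + 1) ^ 6) * (guillera_poly (real n) (real k) / (real k + 1) ^ 6))
        \<longlonglongrightarrow> (if n = 0 then 1 / pi ^ 2 else 0) * 128"
      by (intro tendsto_mult lim guillera_poly_lim)
    moreover have "guillera_term n k * (real k + 1) ^ 6 * (guillera_poly (real n) (real k) / (real k + 1) ^ 6) = G n k" for k
      by (simp add: G_def add_nonneg_eq_0_iff)
    ultimately show ?thesis by (cases "n = 0") auto
  qed
  have "(\<lambda>n. G n 0) sums (128 / pi ^ 2)"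
    using sums_single[of 0 "\<lambda>_. 128 / pi ^ 2"]
    by (intro wz_sums[OF wz _ F_lim b(2) b(1) lim]) (simp_all add: F_def P_def)
  moreover have "G n 0 = (-1) ^ n * (hp n / (fact n * 4 ^ n)) ^ 5 * (820 * real n ^ 2 + 180 * real n + 13)" for n
  proof -
    have "fact (2 * n + 1) = (2 * real n + 1) * fact (2 * n)" by simp
    hence "guillera_term n 0 = (-1) ^ n * hp n ^ 10 / ((2 * real n + 1) ^ 4 * fact (2 * n) ^ 5)"
      unfolding guillera_term_def by (simp add: power_mult_distrib mult.assoc add.commute[of 1] flip: power_add power_Suc2)
    also have "\<dots> = (-1) ^ n * hp n ^ 10 / ((2 * real n + 1) ^ 4 * (4 ^ n * hp n * fact n) ^ 5)"
      by (simp only: fact_double_hp)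
    also have "\<dots> * (2 * real n + 1) ^ 4 = (-1) ^ n * (hp n / (fact n * 4 ^ n)) ^ 5"
      using hp_pos[of n] by (simp add: power_mult_distrib power_divide add_nonneg_eq_0_iff divide_simps flip: power_add)
    finally show ?thesis by (simp add: G_def guillera_poly_0 mult_ac)
  qed
  ultimately show ?thesis by simp
qed

section \<open>The series for 1 / pi^4\<close>

text \<open>The Gosper certificate of the 7F6 pair. The coefficient of k^8 is 16 times the quadratic polynomial of Guillera's series,
and the value at k = 0 contains the quartic polynomial of the theorem.\<close>

definition cullen_poly :: "real \<Rightarrow> real \<Rightarrow> real" where
  "cullen_poly n k =
   (n * (84 + n * (2704 + n * (39360 + n * (337408 + n * (1850240 + n * (6588928 + n * (15039488 + n * (21135360 + n * (16618496 + n * 5591040)))))))))) + k * (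
   (21 + n * (1562 + n * (35860 + n * (423128 + n * (2984880 + n * (13164832 + n * (36228544 + n * (60050560 + n * (54670336 + n * 20966400))))))))) + k * (
   (443/2 + n * (10415 + n * (188658 + n * (1824140 + n * (10409240 + n * (35713488 + n * (71714400 + n * (77243456 + n * 34364160)))))))) + k * (
   (1955/2 + n * (35323 + n * (522150 + n * (4113100 + n * (18433800 + n * (46495120 + n * (60966176 + n * 32185920))))))) + k * (
   (2333 + n * (68660 + n * (835580 + n * (5253600 + n * (17547440 + n * (29167936 + n * 18853440)))))) + k * (
   (3244 + n * (79336 + n * (790944 + n * (3805632 + n * (8534720 + n * 7074432))))) + k * (
   (2624 + n * (53552 + n * (429984 + n * (1448000 + n * 1660800)))) + k * (
   (1144 + n * (19376 + n * (121120 + n * 223040))) + k * (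
   208 + n * (2880 + n * 13120)))))))))"

lemma cullen_poly_growth: "poly_growth 10 8 (\<lambda>n k. cullen_poly (real n) (real k))"
  unfolding cullen_poly_def by (intro poly_growth_horner) simp_all

text \<open>The WZ equation of the 7F6 pair, divided by cullen_term n k and multiplied by (2n+k+2)^5 (k-n+1/2).\<close>

lemma cullen_poly_id:
  "(4*n+k) * (n + k + 1/2) ^ 5 * cullen_poly n (k+1) - (2*n+k+2)^5 * (k-n+1/2) * cullen_poly n k =
   64 * ((4*n+k)*(4*n+k+1)*(4*n+k+2)*(4*n+k+3)) * (3*n+2*k+7/2) * (k-n+1/2) * (n+k+1/2)^5 * (n+1/2)^5 + 2048 * (3*n+2*k+1/2) * ((2*n+k+1)*(2*n)*(2*n+k+2))^5"
  unfolding cullen_poly_def by algebra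

lemma cullen_poly_0: "cullen_poly n 0 = 4*n*(2*n+1)^5 * (43680*n^4+20632*n^3+4340*n^2+466*n+21)"
  unfolding cullen_poly_def by algebra

lemma cullen_poly_lim:
  assumes "n \<ge> 0"
  shows "(\<lambda>k. cullen_poly n (real k) / real k ^ 8) \<longlonglongrightarrow> 16 * (820 * n ^ 2 + 180 * n + 13)"
proof -
  have *: "(\<lambda>k::nat. (a0 + real k * (a1 + real k * (a2 + real k * (a3 + real k * (a4 + real k * (a5 + real k*(a6+real k * (a7 + real k * a8))))))))/real k^8) \<longlonglongrightarrow> a8" if "a8 > 0" for a0 a1 a2 a3 a4 a5 a6 a7 a8
    using that by real_asymp
  have "208 + n * (2880 + n * 13120) = 16 * (820 * n ^ 2 + 180 * n + 13)" by algebra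
  moreover have "208 + n * (2880 + n * 13120) > 0" using assms by (intro add_pos_nonneg) auto
  ultimately show ?thesis unfolding cullen_poly_def by (simp only: *)
qed

lemma half_odd_nonzero: "real k - real n + 1/2 \<noteq> 0"
proof
  assume "real k - real n + 1/2 = 0"
  hence "real (2 * k + 1) = real (2 * n)" by simp
  hence "2 * k + 1 = 2 * n" by (simp only: of_nat_eq_iff)
  thus False by presburger
qed

lemma half_odd_ge: "\<bar>real k - real n + 1/2\<bar> \<ge> 1/2"
  by (cases "k \<ge> n") auto

text \<open>The quotient of (1/2)_n by (1/2 - n)_k is (-1)^n Gamma(1/2) / Gamma(k - n + 1/2); this encoding makes sense for all n
and k without reflecting the Gamma function at k < n. The factorial stands for Gamma(4n+k). Natural subtraction gives
it the value 1 at n = k = 0, where Gamma has a pole.\<close>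

definition cullen_term :: "nat \<Rightarrow> nat \<Rightarrow> real" where
  "cullen_term n k = fact (4*n+k-1) * hp (n + k) ^ 5 * hp n ^ 11 /
     (fact (2*n+k+1) ^ 5 * fact (2*n) ^ 5 * pochhammer (1/2 - real n) k)"

lemma pochhammer_half_minus_nonzero: "pochhammer (1/2 - real n) k \<noteq> 0"
proof
  assume "pochhammer (1/2 - real n) k = 0"
  then obtain j where "1/2 - real n = - real j" by (auto simp: pochhammer_eq_0_iff)
  thus False using half_odd_nonzero[of j n] by simp
qed

lemma cullen_term_Suc_n: "cullen_term (Suc n) k = - cullen_term n k * (fact (4*n+k+3) / fact (4*n+k-1)) *
   (real k - real n - 1/2) * ((real n + real k + 1/2) / ((2*real n+real k+2) * (2*real n+real k+3))) ^ 5 *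
   ((real n + 1/2) / (4 * (real n + 1))) ^ 5"
proof -
  have e: "4 * Suc n + k - 1 = 4 * n + k + 3" by simp
  have f: "fact (2 * Suc n + k + 1) = ((2*real n+real k+2) * (2*real n+real k+3)) * fact (2*n+k+1)"
    by (simp add: algebra_simps)
  have g: "fact (2 * Suc n) = (4 * (real n + 1)) * (real n + 1/2) * fact (2 * n)"
    by (simp add: algebra_simps)
  have h: "hp (Suc n + k) = (real n + real k + 1/2) * hp (n + k)"
    by (simp add: hp_Suc)
  have z: "real k - real n - 1/2 \<noteq> 0" using half_odd_nonzero[of k "Suc n"] by simp
  have "pochhammer (1/2 - real (Suc n)) k * (1/2 - real (Suc n) + real k) = (1/2 - real (Suc n)) * pochhammer (1/2 - real n) k"
    using pochhammer_rec[of "1/2 - real (Suc n)" k] by (simp only: pochhammer_Suc) (simp add: algebra_simps)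
  hence p: "pochhammer (1/2 - real (Suc n)) k = - (real n + 1/2) * pochhammer (1/2 - real n) k / (real k - real n - 1/2)"
    using z by (simp add: field_simps)
  have *: "A' * (a * H) ^ 5 * (b * h) ^ 11 / ((c * F) ^ 5 * (m * b * g) ^ 5 * (- b * p / z)) =
      - (A * H ^ 5 * h ^ 11 / (F ^ 5 * g ^ 5 * p)) * (A' / A) * z * (a / c) ^ 5 * (b / m) ^ 5"
    if "b \<noteq> 0" "A \<noteq> 0" for a b c m p z A A' F H g h :: real
  proof -
    define B where "B = b ^ 5"
    have "b ^ 11 = B * B * b" "B \<noteq> 0"
      using that by (simp_all add: B_def flip: power_add power_Suc2)
    thus ?thesis
      using that by (simp add: power_mult_distrib power_divide ac_simps flip: B_def)
  qed
  show ?thesis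
    unfolding cullen_term_def e f g h hp_Suc p by (rule *) (simp_all add: add_nonneg_eq_0_iff)
qed

lemma cullen_term_Suc_k:
  assumes "n > 0 \<or> k > 0"
  shows "cullen_term n (Suc k) = cullen_term n k * (4*real n+real k) *
     ((real n + real k + 1/2) / (2*real n+real k+2)) ^ 5 / (real k - real n + 1/2)"
proof -
  from assms obtain m where m: "4 * n + k = Suc m" by (cases "4 * n + k") auto
  hence m': "4 * real n + real k = real m + 1" by linarith
  have e: "fact (4 * n + Suc k - 1) = (4*real n+real k) * fact (4*n+k-1)"
  proof -
    have "4 * n + Suc k - 1 = Suc m" "4 * n + k - 1 = m" using m by simp_all
    thus ?thesis unfolding m' by simp
  qed
  have f: "fact (2 * n + Suc k + 1) = (2*real n+real k+2) * fact (2*n+k+1)"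
    by (simp add: algebra_simps)
  have h: "hp (n + Suc k) = (real n + real k + 1/2) * hp (n + k)"
    by (simp add: hp_Suc)
  have p: "pochhammer (1/2 - real n) (Suc k) = (real k - real n + 1/2) * pochhammer (1/2 - real n) k"
    by (simp add: pochhammer_Suc algebra_simps)
  show ?thesis
    unfolding cullen_term_def e f h p
    by (simp only: power_mult_distrib power_divide times_divide_times_eq times_divide_eq_right times_divide_eq_left divide_divide_eq_left ac_simps)
qed

lemma fact_ratio:
  assumes "n > 0 \<or> k > 0"
  shows "fact (4*n+k+3) / fact (4*n+k-1) =
     (4*real n+real k) * (4*real n+real k+1) * (4*real n+real k+2) * (4*real n+real k+3)"
proof -
  from assms obtain m where m: "4 * n + k = Suc m" by (cases "4 * n + k") auto
  hence m': "4 * real n + real k = real m + 1" by linarith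
  have "fact (Suc m + 3) = ((real m + 1) * (real m + 1 + 1) * (real m + 1 + 2) * (real m + 1 + 3)) * fact m"
    by (simp add: numeral_3_eq_3 algebra_simps)
  thus ?thesis unfolding m m' by simp
qed

text \<open>Unlike the exact ratio, this bound also covers m = 0, where m - 1 is truncated.\<close>

lemma fact_ratio_le: "fact (m + 3) / fact (m - 1) \<le> (real m + 3) ^ 4"
proof -
  have "fact m \<le> (real m + 3) * fact (m - 1)"
    by (cases m) (auto intro!: mult_right_mono)
  hence "(real m + 3) * (real m + 2) * (real m + 1) * fact m \<le>
      (real m + 3) * (real m + 3) * (real m + 3) * ((real m + 3) * fact (m - 1))"
    by (intro mult_mono) auto
  moreover have "fact (m + 3) = (real m + 3) * (real m + 2) * (real m + 1) * fact m"
    by (simp add: numeral_3_eq_3 algebra_simps)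
  ultimately show ?thesis
    by (simp add: divide_le_eq power4_eq_xxxx mult_ac)
qed

text \<open>Write X = 2n + k + 2. The quotient of factorials contributes at most 16 X^4 and the linear factor at most X, which is
compensated by the fifth power of 1 / X; the remaining factor is at most 4^(-5). So the ratio is at most 1/64.\<close>

lemma cullen_term_decay: "\<bar>cullen_term (Suc n) k\<bar> \<le> \<bar>cullen_term n k\<bar> / 4"
proof -
  define X where "X = 2 * real n + real k + 2"
  have X: "X > 0" by (simp add: X_def add_nonneg_pos)
  have "real (4 * n + k) + 3 \<le> 2 * X" by (simp add: X_def)
  hence "(real (4 * n + k) + 3) ^ 4 \<le> (2 * X) ^ 4" by (intro power_mono) auto
  with fact_ratio_le[of "4 * n + k"] have 1: "fact (4*n+k+3) / fact (4*n+k-1) \<le> 16 * X ^ 4"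
    by (simp add: power_mult_distrib)
  have 2: "\<bar>real k - real n - 1/2\<bar> \<le> X" by (simp add: X_def abs_le_iff)
  have "(real n + real k + 1/2) / (X * (2*real n+real k+3)) \<le> 1 / X"
    using X by (simp add: divide_simps)
  hence 3: "((real n + real k + 1/2) / (X * (2*real n+real k+3))) ^ 5 \<le> (1 / X) ^ 5"
    using X by (intro power_mono) auto
  have "(real n + 1/2) / (4 * (real n + 1)) \<le> 1 / 4" by (simp add: divide_simps)
  hence 4: "((real n + 1/2) / (4 * (real n + 1))) ^ 5 \<le> (1 / 4) ^ 5"
    by (intro power_mono) auto
  have "fact (4*n+k+3) / fact (4*n+k-1) * \<bar>real k - real n - 1/2\<bar> * ((real n + real k + 1/2) / (X * (2*real n+real k+3))) ^ 5 *
     ((real n + 1/2) / (4 * (real n + 1))) ^ 5 \<le> 16 * X ^ 4 * X * (1 / X) ^ 5 * (1 / 4) ^ 5"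
    using X by (intro mult_mono 1 2 3 4) auto
  also have "\<dots> = 1 / 64" using X by (simp add: power_divide power_eq_if)
  also have "\<dots> \<le> (1 / 4 :: real)" by simp
  finally have "\<bar>cullen_term n k\<bar> * (fact (4*n+k+3) / fact (4*n+k-1) * \<bar>real k - real n - 1/2\<bar> * ((real n + real k + 1/2) / (X * (2*real n+real k+3))) ^ 5 *
     ((real n + 1/2) / (4 * (real n + 1))) ^ 5) \<le> \<bar>cullen_term n k\<bar> * (1 / 4)"
    by (intro mult_left_mono) auto
  thus ?thesis
    using X by (simp add: cullen_term_Suc_n abs_mult mult.assoc power_abs flip: X_def)
qed

lemma cullen_term_0:
  "cullen_term 0 k = (hp k / fact k) ^ 4 * fact (k - 1) / (fact k * (real k + 1) ^ 5)"
proof -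
  have "A * h ^ 5 / ((x * f) ^ 5 * h) = (h / f) ^ 4 * A / (f * x ^ 5)" if "h \<noteq> 0" for A h x f :: real
    using that power_Suc[of h 4] power_Suc[of f 4] by (simp add: power_mult_distrib power_divide ac_simps)
  from this[of "hp k" "fact (k - 1)" "real k + 1" "fact k"] show ?thesis
    using hp_pos[of k] by (simp add: cullen_term_def add_ac)
qed

lemma cullen_term_0_le: "\<bar>cullen_term 0 k\<bar> \<le> 2 / (real k + 1) ^ 8"
proof -
  have "(hp k / fact k) ^ 2 \<le> 1 / (real k + 1)"
    using hp_bound[of k] by (simp add: divide_simps)
  hence "((hp k / fact k) ^ 2) ^ 2 \<le> (1 / (real k + 1)) ^ 2"
    by (intro power_mono) auto
  hence 1: "(hp k / fact k) ^ 4 \<le> 1 / (real k + 1) ^ 2"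
    by (simp add: power_divide flip: power_mult)
  have 2: "fact (k - 1) / fact k \<le> 2 / (real k + 1)"
    by (cases k) (auto simp: divide_simps)
  have "(hp k / fact k) ^ 4 * (fact (k - 1) / fact k) * (1 / (real k + 1) ^ 5) \<le>
      1 / (real k + 1) ^ 2 * (2 / (real k + 1)) * (1 / (real k + 1) ^ 5)"
    by (intro mult_mono 1 2) auto
  also have "\<dots> = 2 / (real k + 1) ^ 8"
    by (simp flip: power_add power_Suc2)
  finally show ?thesis using hp_pos[of k] by (simp add: cullen_term_0)
qed

text \<open>For fixed n the ratio of consecutive terms is a rational function of k, so the limit follows by induction on n from
the product of Wallis at n = 0.\<close>

lemma cullen_term_lim:
  "(\<lambda>k. cullen_term n k * real k ^ 8) \<longlonglongrightarrow> 1 / pi ^ 2 * ((-1) ^ n * (hp n / (fact n * 4 ^ n)) ^ 5)"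
proof (induction n)
  case 0
  have "(\<lambda>k. ((hp k / fact k) ^ 2 * real k) ^ 2 * (real k / (real k + 1)) ^ 5) \<longlonglongrightarrow> (1 / pi) ^ 2 * 1"
    by (intro tendsto_mult tendsto_power[OF wallis_hp]) real_asymp
  moreover have "\<forall>\<^sub>F k in sequentially. ((hp k / fact k) ^ 2 * real k) ^ 2 * (real k / (real k + 1)) ^ 5 = cullen_term 0 k * real k ^ 8"
    using eventually_gt_at_top[of 0]
  proof eventually_elim
    case (elim k)
    hence "fact k = real k * fact (k - 1)" by (simp add: fact_reduce)
    moreover have "((h / f) ^ 2 * x) ^ 2 * (x / y) ^ 5 = (h / f) ^ 4 * g / (f * y ^ 5) * x ^ 8"
      if "f = x * g" "x > 0" "g > 0" for h f x y g :: real
      unfolding that(1) using that(2,3) by (simp add: power_mult_distrib power_divide divide_simps flip: power_mult power_add)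
        (auto simp flip: power_Suc2)
    ultimately show ?case using elim by (simp add: cullen_term_0)
  qed
  ultimately show ?case by (simp add: filterlim_cong power_divide)
next
  case (Suc n)
  define x where "x = real n"
  have 1: "(\<lambda>k::nat. ((4*x+real k)*(4*x+real k+1)*(4*x+real k+2)*(4*x+real k+3)) * (real k-x-1/2) * ((x+real k+1/2)/((2*x+real k+2)*(2*x+real k+3)))^5) \<longlonglongrightarrow> 1"
    by real_asymp
  have "(\<lambda>k. - (cullen_term n k * real k ^ 8) * (((4*x+real k)*(4*x+real k+1)*(4*x+real k+2)*(4*x+real k+3)) * (real k-x-1/2) * ((x+real k+1/2)/((2*x+real k+2)*(2*x+real k+3)))^5) * ((x + 1/2) / (4 * (x + 1))) ^ 5)
     \<longlonglongrightarrow> - (1 / pi ^ 2 * ((-1) ^ n * (hp n / (fact n * 4 ^ n)) ^ 5)) * 1 * ((x + 1/2) / (4 * (x + 1))) ^ 5"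
    by (intro tendsto_mult tendsto_minus Suc.IH tendsto_const 1)
  also have "- (1 / pi ^ 2 * ((-1) ^ n * (hp n / (fact n * 4 ^ n)) ^ 5)) * 1 * ((x + 1/2) / (4 * (x + 1))) ^ 5 =
     1 / pi ^ 2 * ((-1) ^ Suc n * (hp (Suc n) / (fact (Suc n) * 4 ^ Suc n)) ^ 5)"
    by (simp add: x_def hp_Suc power_mult_distrib power_divide ac_simps del: distrib_left_numeral distrib_right_numeral)
  finally show ?case
  proof (rule Lim_transform_eventually)
    show "\<forall>\<^sub>F k in sequentially. - (cullen_term n k * real k ^ 8) * (((4*x+real k)*(4*x+real k+1)*(4*x+real k+2)*(4*x+real k+3)) * (real k-x-1/2) * ((x+real k+1/2)/((2*x+real k+2)*(2*x+real k+3)))^5) * ((x + 1/2) / (4 * (x + 1))) ^ 5 =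
        cullen_term (Suc n) k * real k ^ 8"
      using eventually_gt_at_top[of 0]
    proof eventually_elim
      case (elim k)
      hence "fact (4*n+k+3) / fact (4*n+k-1) = (4*x+real k)*(4*x+real k+1)*(4*x+real k+2)*(4*x+real k+3)"
        unfolding x_def by (intro fact_ratio) auto
      thus ?case unfolding cullen_term_Suc_n by (simp only: x_def mult_ac minus_mult_left minus_mult_right)
    qed
  qed
qed

text \<open>At k = 0 the factorials of even argument are reduced by the duplication formula, applied twice to (4n)!, which
contributes the Pochhammer symbols of 1/4 and 3/4.\<close>

lemma cullen_at_0:
  assumes "n \<noteq> 0"
  shows "cullen_term n 0 * cullen_poly (real n) 0 =
    (pochhammer (1/2 :: real) n ^ 7 * pochhammer (1/4) n * pochhammer (3/4) n) / fact n ^ 9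
      * (1 / 2 ^ (12 * n))
      * (43680 * real n ^ 4 + 20632 * real n ^ 3 + 4340 * real n ^ 2 + 466 * real n + 21)"
proof -
  define q where "q = 43680 * real n ^ 4 + 20632 * real n ^ 3 + 4340 * real n ^ 2 + 466 * real n + 21"
  define h d where "h = hp n" and "d = pochhammer (1/4 :: real) n * pochhammer (3/4) n"
  have f1: "fact (2 * n + 1) = (2 * real n + 1) * fact (2 * n)" by simp
  have "hp (2 * n) = 4 ^ n * d"
    using pochhammer_double[of "1/4 :: real" n] by (simp add: d_def power_mult mult.assoc)
  hence "fact (2 * (2 * n)) = 4 ^ (2 * n) * (4 ^ n * d) * (4 ^ n * h * fact n)"
    by (simp only: fact_double_hp h_def)
  hence "fact (4 * n) = 256 ^ n * d * h * fact n"
    by (simp add: power_mult flip: power_mult_distrib)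
  moreover have "fact (4 * n) = 4 * real n * fact (4 * n - 1)"
    using assms by (simp add: fact_reduce)
  ultimately have f2: "4 * real n * fact (4 * n - 1) = 256 ^ n * d * h * fact n" by simp
  have f3: "cullen_term n 0 = fact (4 * n - 1) * h ^ 16 / (((2 * real n + 1) * fact (2 * n)) ^ 5 * fact (2 * n) ^ 5)"
    unfolding f1[symmetric] by (simp add: cullen_term_def h_def flip: power_add)
  have "cullen_term n 0 * cullen_poly (real n) 0 = (4 * real n * fact (4 * n - 1)) * h ^ 16 / (4 ^ n * h * fact n) ^ 10 * q"
    using assms unfolding fact_double_hp[of n, folded h_def, symmetric]
    by (simp add: f3 cullen_poly_0 q_def[symmetric] power_mult_distrib add_nonneg_eq_0_iff divide_simps flip: power_add)
  also have "\<dots> = h ^ 7 * d / fact n ^ 9 * (1 / 2 ^ (12 * n)) * q"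
  proof -
    have e: "w ^ 4 * d * h * f * h ^ 16 / (w * h * f) ^ 10 = (h ^ 7 * d) / (f ^ 9 * w ^ 6)"
      if "w > 0" "h > 0" "f > 0" for d h f w :: real
    proof -
      have "w ^ 4 * d * h * f * h ^ 16 * (f ^ 9 * w ^ 6) = h ^ 7 * d * (w * h * f) ^ 10" by algebra
      thus ?thesis using that by (subst frac_eq_eq) auto
    qed
    have "(256 :: real) ^ n = (4 ^ 4) ^ n" by simp
    also have "\<dots> = (4 ^ n) ^ 4" by (simp only: mult.commute flip: power_mult)
    finally have p1: "(256 :: real) ^ n = (4 ^ n) ^ 4" .
    have "(2 :: real) ^ (12 * n) = (4 ^ 6) ^ n" by (simp add: power_mult)
    also have "\<dots> = (4 ^ n) ^ 6" by (simp only: mult.commute flip: power_mult)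
    finally have p2: "(2 :: real) ^ (12 * n) = (4 ^ n) ^ 6" .
    show ?thesis unfolding f2 p1 p2 by (subst e) (auto simp: h_def hp_pos)
  qed
  finally show ?thesis by (simp add: q_def h_def d_def mult_ac)
qed

theorem mainTheorem1:
  "(\<lambda>n::nat.
      (pochhammer (1/2 :: real) n ^ 7 * pochhammer (1/4) n * pochhammer (3/4) n) / fact n ^ 9
        * (1 / 2 ^ (12 * n))
        * (43680 * real n ^ 4 + 20632 * real n ^ 3 + 4340 * real n ^ 2 + 466 * real n + 21))
    sums (2048 / pi ^ 4)"
proof -
  \<comment> \<open>At n = k = 0 the pole of Gamma(4n+k) meets a zero of the polynomial; 21 is the value of the product there.\<close>
  define G where "G = (\<lambda>n k. if n = 0 \<and> k = 0 then 21 else cullen_term n k * cullen_poly (real n) (real k))"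
  define P where "P = (\<lambda>n k. - 2048 * (3*n+2*k+1/2) * ((2*n+k+1) * (2*n)) ^ 5 :: real)"
  define F where "F = (\<lambda>n k. cullen_term n k * P (real n) (real k) / (real k - real n + 1/2))"

  have wz: "F (Suc n) k - F n k = G n (Suc k) - G n k" if pos: "n > 0 \<or> k > 0" for n k
  proof -
    define t x y X z where "t = cullen_term n k" and "x = real n" and "y = real k"
      and "X = 2*x+y+2" and "z = y - x + 1/2"
    have "X > 0" "x + 1 > 0" "2*x+y+3 > 0" unfolding X_def x_def y_def by auto
    hence nz: "X \<noteq> 0" "x + 1 \<noteq> 0" "2*x+y+3 \<noteq> 0" "z \<noteq> 0" "y - x - 1/2 \<noteq> 0"
      using half_odd_nonzero[of k n] half_odd_nonzero[of k "Suc n"] by (auto simp: z_def x_def y_def)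
    define M where "M = (4*x+y)*(4*x+y+1)*(4*x+y+2)*(4*x+y+3)"
    have M: "fact (4*n+k+3) / fact (4*n+k-1) = M"
      using fact_ratio[OF pos] by (simp only: M_def x_def y_def)
    have "F (Suc n) k = (- t * M * (y - x - 1/2) * ((x+y+1/2) / (X * (2*x+y+3))) ^ 5 * ((x+1/2) / (4 * (x+1))) ^ 5) *
             (- 2048 * (3*x+2*y+7/2) * ((2*x+y+3) * (2 * (x+1))) ^ 5) / (y - x - 1/2)"
    proof -
      have "P (real (Suc n)) (real k) = - 2048 * (3*x+2*y+7/2) * ((2*x+y+3) * (2 * (x+1))) ^ 5"
        by (simp add: P_def x_def y_def algebra_simps)
      moreover have "real k - real (Suc n) + 1/2 = y - x - 1/2" by (simp add: x_def y_def)
      ultimately show ?thesis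
        by (simp only: F_def cullen_term_Suc_n M) (simp only: t_def x_def y_def X_def)
    qed
    also have "\<dots> = t * (64 * M * (3*x+2*y+7/2) * (x+y+1/2)^5 * (x+1/2)^5) / X^5"
      using nz by (simp add: power_mult_distrib power_divide mult_ac del: distrib_left_numeral distrib_right_numeral)
    finally have F: "F (Suc n) k = t * (64 * M * (3*x+2*y+7/2) * (x+y+1/2)^5 * (x+1/2)^5) / X^5" .
    \<comment> \<open>Multiplying by X^5 z clears all denominators and leads to the polynomial identity.\<close>
    have 1: "X ^ 5 * z * F (Suc n) k = t * (64 * M * (3*x+2*y+7/2) * z * (x+y+1/2)^5 * (x+1/2)^5)"
      unfolding F using nz by (simp add: mult_ac del: distrib_left_numeral distrib_right_numeral)
    have "F n k = t * (- 2048 * (3*x+2*y+1/2) * ((2*x+y+1) * (2*x)) ^ 5) / z"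
      by (simp only: F_def P_def t_def x_def y_def z_def)
    hence 2: "X ^ 5 * z * F n k = - t * (2048 * (3*x+2*y+1/2) * ((2*x+y+1) * (2*x) * X) ^ 5)"
      using nz(4) by (simp add: power_mult_distrib mult_ac del: distrib_left_numeral distrib_right_numeral)
    have "G n (Suc k) = t * (4*x+y) * ((x+y+1/2) / X) ^ 5 / z * cullen_poly x (y+1)"
      unfolding G_def using pos by (simp add: cullen_term_Suc_k t_def x_def y_def X_def z_def add_ac)
    hence 3: "X ^ 5 * z * G n (Suc k) = t * ((4*x+y) * (x+y+1/2) ^ 5 * cullen_poly x (y+1))"
      using nz by (simp add: power_divide)
    have 4: "X ^ 5 * z * G n k = t * (X ^ 5 * z * cullen_poly x y)"
      using pos by (auto simp: G_def t_def x_def y_def)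
    have "X ^ 5 * z * (F (Suc n) k - F n k) =
       t * (64 * M * (3*x+2*y+7/2) * z * (x+y+1/2)^5 * (x+1/2)^5 + 2048 * (3*x+2*y+1/2) * ((2*x+y+1) * (2*x) * X) ^ 5)"
      unfolding right_diff_distrib[of "X ^ 5 * z"] 1 2 distrib_left[of t] by simp
    also have "\<dots> = t * ((4*x+y) * (x+y+1/2) ^ 5 * cullen_poly x (y+1) - X ^ 5 * z * cullen_poly x y)"
      unfolding M_def X_def z_def cullen_poly_id ..
    also have "\<dots> = X ^ 5 * z * (G n (Suc k) - G n k)"
      unfolding right_diff_distrib[of "X ^ 5 * z"] 3 4 by (rule right_diff_distrib)
    finally show ?thesis using nz by simp
  qed
  have wz0: "F (Suc 0) 0 - F 0 0 = G 0 (Suc 0) - G 0 0"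
    by (simp add: F_def P_def G_def cullen_term_def cullen_poly_def fact_numeral power_one_over)
  have wz: "F (Suc n) k - F n k = G n (Suc k) - G n k" for n k
    using wz[of n k] wz0 by (cases "n = 0 \<and> k = 0") auto

  have lin: "poly_growth 1 1 (\<lambda>n k. a + (real n * b + real k * c))" for a b c
    by (intro poly_growth_horner) simp_all
  \<comment> \<open>The factor 2 makes up for the division by k - n + 1/2, which is at least 1/2 in absolute value.\<close>
  have P: "poly_growth (1 + (5 * (1 + 1))) (1 + (5 * (1 + 1))) (\<lambda>n k. 2 * P (real n) (real k))"
    using poly_growth_mult[OF lin[of "-2048" "-12288" "-8192"]
            poly_growth_power[OF poly_growth_mult[OF lin[of 1 2 1] lin[of 0 2 0]], of 5]]
    by (simp add: P_def algebra_simps)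
  have F_lim: "(\<lambda>n. F n k) \<longlonglongrightarrow> 0" for k
  proof (rule tendsto_0_if_poly_growth[where D = cullen_term and k = k, OF cullen_term_decay P])
    fix n
    have "\<bar>cullen_term n k * P (real n) (real k)\<bar> * (1/2) \<le>
          \<bar>cullen_term n k * P (real n) (real k)\<bar> * \<bar>real k - real n + 1/2\<bar>"
      using half_odd_ge[of k n] by (intro mult_left_mono) auto
    thus "\<bar>F n k\<bar> \<le> \<bar>cullen_term n k * (2 * P (real n) (real k))\<bar>"
      using half_odd_ge[of k n] by (simp add: F_def abs_mult divide_le_eq)
  qed
  obtain b0 where b0: "summable b0" "\<And>n k. \<bar>cullen_term n k * cullen_poly (real n) (real k)\<bar> \<le> b0 n"
    using uniform_bound_if_poly_growth[OF cullen_term_decay cullen_poly_growth cullen_term_0_le] by blast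
  define b where "b = (\<lambda>n. b0 n + (if n = 0 then 21 else 0))"
  have b: "summable b"
    unfolding b_def using sums_single[of 0 "\<lambda>_. 21 :: real"] by (intro summable_add b0) (auto simp: sums_iff)
  have b': "\<bar>G n k\<bar> \<le> b n" for n k
    using b0(2)[of n k] order_trans[OF abs_ge_zero b0(2)[of n k]] by (auto simp: G_def b_def)

  define g where "g = (\<lambda>n. (-1) ^ n * (hp n / (fact n * 4 ^ n)) ^ 5 * (820 * real n ^ 2 + 180 * real n + 13))"
  have lim: "(\<lambda>k. G n k) \<longlonglongrightarrow> 16 / pi ^ 2 * g n" for n
  proof -
    have "(\<lambda>k. (cullen_term n k * real k ^ 8) * (cullen_poly (real n) (real k) / real k ^ 8))
        \<longlonglongrightarrow> 1 / pi ^ 2 * ((-1) ^ n * (hp n / (fact n * 4 ^ n)) ^ 5) * (16 * (820 * real n ^ 2 + 180 * real n + 13))"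
      by (intro tendsto_mult cullen_term_lim cullen_poly_lim) auto
    also have "1 / pi ^ 2 * ((-1) ^ n * (hp n / (fact n * 4 ^ n)) ^ 5) * (16 * (820 * real n ^ 2 + 180 * real n + 13)) =
        16 / pi ^ 2 * g n" by (simp add: g_def)
    finally show ?thesis
    proof (rule Lim_transform_eventually)
      show "\<forall>\<^sub>F k in sequentially. (cullen_term n k * real k ^ 8) * (cullen_poly (real n) (real k) / real k ^ 8) = G n k"
        using eventually_gt_at_top[of 0] by eventually_elim (simp add: G_def)
    qed
  qed
  have "(\<lambda>n. 16 / pi ^ 2 * g n) sums (16 / pi ^ 2 * (128 / pi ^ 2))"
    unfolding g_def by (intro sums_mult guillera_sums)
  hence "(\<lambda>n. G n 0) sums (16 / pi ^ 2 * (128 / pi ^ 2))"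
    by (intro wz_sums[OF wz _ F_lim b' b lim]) (simp_all add: F_def P_def)
  moreover have "16 / pi ^ 2 * (128 / pi ^ 2) = 2048 / pi ^ 4" by (simp flip: power_add)
  moreover have "G n 0 = (pochhammer (1/2 :: real) n ^ 7 * pochhammer (1/4) n * pochhammer (3/4) n) / fact n ^ 9
        * (1 / 2 ^ (12 * n))
        * (43680 * real n ^ 4 + 20632 * real n ^ 3 + 4340 * real n ^ 2 + 466 * real n + 21)" for n
    using cullen_at_0[of n] by (cases "n = 0") (simp_all add: G_def)
  ultimately show ?thesis by simp
qed

end
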